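(* Let $\mathcal{G}=(\mathcal{V},\mathcal{E})$ be a finite undirected graph with nonempty node set, with nonnegative edge weights $\mathcal{S}_{i,j}\ge0$ for $(u_i,u_j)\in\mathcal{E}$ and nonnegative node weights $\mathcal{S}_i\ge 0$ for $u_i\in\mathcal{V}$. For nonempty $Q\subseteq\mathcal{V}$ define $$\mathcal{F}_{[Q]}=\frac{\sum_{(u_i,u_j)\in\mathcal{E},\,u_i,u_j\in Q}\mathcal{S}_{i,j}+\sum_{u_i\in Q}\mathcal{S}_i}{|Q|},\qquad w(u_i,[Q])=\sum_{u_j\in Q,\,(u_i,u_j)\in\mathcal{E}}\mathcal{S}_{i,j}+\mathcal{S}_i\quad(u_i\in Q).$$ Consider the following procedure (Algorithm 2). Set $\mathcal{V}_c=\mathcal{V}$ and record $\mathcal{V}_c$. While $\mathcal{V}_c\neq\emptyset$: let $Q'=\mathcal{V}_c$, compute $R=\{u\in Q': w(u,[Q'])\le \frac{1}{|Q'|}\sum_{v\in Q'}w(v,[Q'])\}$, sort $R$ in increasing order of $w(\cdot,[Q'])$, and then remove the nodes of $R$ from $\mathcal{V}_c$ one at a time in this order, recording the current set $\mathcal{V}_c$ after each removal whenever it is nonempty. Finally output $Q$, a recorded nonempty set maximizing $\mathcal{F}_{[Q]}$ among all recorded sets. Let $Q^*$ be a nonempty subset of $\mathcal{V}$ maximizing $\mathcal{F}_{[Q^*]}$. Then $\mathcal{F}_{[Q]}\ge\frac12\mathcal{F}_{[Q^*]}$.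
   Context: $[Q]$ denotes the subgraph of $\mathcal{G}$ induced by the node set $Q$. The quantity $\frac{1}{|Q'|}\sum_{v\in Q'}w(v,[Q'])$ equals $\frac{2\sum_{\text{edges in }[Q']}\mathcal{S}_{i,j}+\sum_{u_i\in Q'}\mathcal{S}_i}{|Q'|}$; since $R$ always contains a node of minimal $w$, the set $R$ is nonempty and the procedure terminates. *)

theory Defs
  imports Complex_Main
begin

text \<open>
  A simple undirected graph is given by its node set and a set \<open>E\<close> of two-element sets of nodes.
  Edge weights \<open>s\<close> are indexed by edges, so that \<open>s {u, v}\<close> is automatically symmetric
  in \<open>u\<close> and \<open>v\<close>; node weights are \<open>c\<close>.
\<close>

definition simple_graph :: "'a set \<Rightarrow> 'a set set \<Rightarrow> bool" where
  "simple_graph V E \<longleftrightarrow> (\<forall>e\<in>E. \<exists>u\<in>V. \<exists>v\<in>V. u \<noteq> v \<and> e = {u, v})"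

definition density :: "'a set set \<Rightarrow> ('a set \<Rightarrow> real) \<Rightarrow> ('a \<Rightarrow> real) \<Rightarrow> 'a set \<Rightarrow> real" where
  "density E s c Q = ((\<Sum>e\<in>{e \<in> E. e \<subseteq> Q}. s e) + (\<Sum>u\<in>Q. c u)) / real (card Q)"

definition weight_in :: "'a set set \<Rightarrow> ('a set \<Rightarrow> real) \<Rightarrow> ('a \<Rightarrow> real) \<Rightarrow> 'a set \<Rightarrow> 'a \<Rightarrow> real" where
  "weight_in E s c Q u = (\<Sum>v\<in>{v \<in> Q. {u, v} \<in> E}. s {u, v}) + c u"

definition low_nodes :: "'a set set \<Rightarrow> ('a set \<Rightarrow> real) \<Rightarrow> ('a \<Rightarrow> real) \<Rightarrow> 'a set \<Rightarrow> 'a set" where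
  "low_nodes E s c Q =
    {u \<in> Q. weight_in E s c Q u \<le> (\<Sum>v\<in>Q. weight_in E s c Q v) / real (card Q)}"

text \<open>
  Ties may be broken arbitrarily when sorting, so a sorting of the low nodes is specified by a
  predicate, and one pass of the outer loop is a relation rather than a function.
  A state consists of the current node set and the family of sets recorded so far.
\<close>

definition removal_order ::
    "'a set set \<Rightarrow> ('a set \<Rightarrow> real) \<Rightarrow> ('a \<Rightarrow> real) \<Rightarrow> 'a set \<Rightarrow> 'a list \<Rightarrow> bool" where
  "removal_order E s c Q us \<longleftrightarrow>
    distinct us \<and> set us = low_nodes E s c Q \<and>
    sorted_wrt (\<lambda>u v. weight_in E s c Q u \<le> weight_in E s c Q v) us"

fun remove_node :: "'a \<Rightarrow> 'a set \<times> 'a set set \<Rightarrow> 'a set \<times> 'a set set" where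
  "remove_node u (Q, recs) =
    (Q - {u}, if Q - {u} = {} then recs else insert (Q - {u}) recs)"

inductive peel_round ::
    "'a set set \<Rightarrow> ('a set \<Rightarrow> real) \<Rightarrow> ('a \<Rightarrow> real) \<Rightarrow>
      'a set \<times> 'a set set \<Rightarrow> 'a set \<times> 'a set set \<Rightarrow> bool"
  for E s c where
  "Q \<noteq> {} \<Longrightarrow> removal_order E s c Q us \<Longrightarrow>
    peel_round E s c (Q, recs) (fold remove_node us (Q, recs))"

definition peel_output ::
    "'a set \<Rightarrow> 'a set set \<Rightarrow> ('a set \<Rightarrow> real) \<Rightarrow> ('a \<Rightarrow> real) \<Rightarrow> 'a set \<Rightarrow> bool" where
  "peel_output V E s c Q \<longleftrightarrow>
    (\<exists>recs. (peel_round E s c)\<^sup>*\<^sup>* (V, {V}) ({}, recs) \<and>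
      is_arg_max (density E s c) (\<lambda>Q'. Q' \<in> recs) Q)"

text \<open>
  The procedure cannot get stuck and terminates: each round removes at least one node. Hence
  \<open>peel_output\<close> is satisfiable.
\<close>

lemma fst_fold_remove_node: "fst (fold remove_node us (Q, recs)) = Q - set us"
proof (induction us arbitrary: Q recs)
  case (Cons u us)
  then show ?case by auto
qed simp

lemma snd_fold_remove_node:
  "finite recs \<Longrightarrow> recs \<subseteq> snd (fold remove_node us (Q, recs)) \<and>
    finite (snd (fold remove_node us (Q, recs)))"
proof (induction us arbitrary: Q recs)
  case (Cons u us)
  show ?case
    using Cons.IH[of recs "Q - {u}"] Cons.IH[of "insert (Q - {u}) recs" "Q - {u}"] Cons.prems
    by (auto simp del: insert_subset)
qed simp

lemma low_nodes_nonempty: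
  assumes "finite Q" "Q \<noteq> {}"
  shows "low_nodes E s c Q \<noteq> {}"
proof
  let ?w = "weight_in E s c Q" and ?avg = "(\<Sum>v\<in>Q. weight_in E s c Q v) / real (card Q)"
  assume "low_nodes E s c Q = {}"
  then have "(\<Sum>v\<in>Q. ?avg) < (\<Sum>v\<in>Q. ?w v)"
    using assms by (intro sum_strict_mono) (auto simp: low_nodes_def not_le)
  then show False using assms by simp
qed

lemma removal_order_exists:
  assumes "finite Q"
  obtains us where "removal_order E s c Q us"
proof -
  have "finite (low_nodes E s c Q)" using assms by (simp add: low_nodes_def)
  then obtain xs where "set xs = low_nodes E s c Q" "distinct xs"
    using finite_distinct_list by blast
  then have "removal_order E s c Q (sort_key (weight_in E s c Q) xs)"
    using sorted_sort_key[of "weight_in E s c Q" xs]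
    by (simp add: removal_order_def sorted_map)
  then show thesis by (rule that)
qed

lemma peel_round_decreases:
  assumes "peel_round E s c (Q, recs) (Q', recs')" "finite Q"
  shows "Q' \<subset> Q"
  using assms(1)
proof cases
  case (1 us)
  have "Q' = Q - low_nodes E s c Q"
    using 1 fst_fold_remove_node[of us Q recs] by (metis fst_conv removal_order_def)
  moreover have "low_nodes E s c Q \<subseteq> Q" by (auto simp: low_nodes_def)
  ultimately show ?thesis using low_nodes_nonempty[OF assms(2) 1(2)] by blast
qed

lemma peel_terminates:
  assumes "finite Q" "finite recs"
  shows "\<exists>recs'. (peel_round E s c)\<^sup>*\<^sup>* (Q, recs) ({}, recs') \<and> recs \<subseteq> recs' \<and> finite recs'"
  using assms
proof (induction Q arbitrary: recs rule: finite_psubset_induct)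
  case (psubset Q)
  show ?case
  proof (cases "Q = {}")
    case False
    obtain us where us: "removal_order E s c Q us"
      using removal_order_exists psubset.hyps by blast
    obtain Q' recs1 where eq: "fold remove_node us (Q, recs) = (Q', recs1)"
      by (cases "fold remove_node us (Q, recs)")
    have step: "peel_round E s c (Q, recs) (Q', recs1)"
      using peel_round.intros[OF False us, of recs] eq by simp
    have "recs \<subseteq> recs1" "finite recs1"
      using snd_fold_remove_node[OF psubset.prems, of us Q] eq by auto
    then show ?thesis
      using psubset.IH[OF peel_round_decreases[OF step psubset.hyps], of recs1] step
      by (meson converse_rtranclp_into_rtranclp order_trans)
  qed (use psubset.prems in auto)
qed

lemma peel_output_exists:
  assumes "finite V"
  shows "\<exists>Q. peel_output V E s c Q"
proof -
  obtain recs where recs: "(peel_round E s c)\<^sup>*\<^sup>* (V, {V}) ({}, recs)" "V \<in> recs" "finite recs"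
    using peel_terminates[OF assms, of "{V}" E s c] by auto
  then obtain Q where "Q \<in> recs" "density E s c Q = Max (density E s c ` recs)"
    by (metis (no_types, lifting) Max_in empty_iff finite_imageI image_iff image_is_empty)
  then have "is_arg_max (density E s c) (\<lambda>Q'. Q' \<in> recs) Q"
    using recs(3) by (auto simp: is_arg_max_linorder)
  then show ?thesis using recs(1) by (auto simp: peel_output_def)
qed

end

(*
  If u belongs to the optimal set Q*, then w(u,[Q*]) is at least F[Q*], since otherwise deleting u
  would increase the density. Look at the first round that removes a node u of Q*, and let Q' be
  the (recorded) node set at its start. As Q* is contained in Q', F[Q*] is at most w(u,[Q']), which
  is at most the average of w over Q' because u is removed; and this average is at most 2 F[Q'],
  because every edge is counted twice and every node once.
*)
theory Submission
  imports Defs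
begin

definition edges_in :: "'a set set \<Rightarrow> 'a set \<Rightarrow> 'a set set" where
  "edges_in E Q = {e \<in> E. e \<subseteq> Q}"

lemma finite_edges_in: "finite Q \<Longrightarrow> finite (edges_in E Q)"
  by (rule finite_subset[of _ "Pow Q"]) (auto simp: edges_in_def)

lemma density_eq: "density E s c Q = (sum s (edges_in E Q) + sum c Q) / real (card Q)"
  by (simp add: density_def edges_in_def)

text \<open>In a simple graph the neighbours \<open>v\<close> of \<open>u\<close> correspond one to
  one to the edges \<open>{u, v}\<close>. Sums over incident edges suit both the double counting and
  the deletion of a node below.\<close>

lemma weight_in_eq:
  assumes "simple_graph V E" "u \<in> Q"
  shows "weight_in E s c Q u = sum s {e \<in> edges_in E Q. u \<in> e} + c u"
proof -
  have inj: "inj_on (\<lambda>v. {u, v}) {v \<in> Q. {u, v} \<in> E}"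
    by (auto simp: inj_on_def doubleton_eq_iff)
  have "(\<lambda>v. {u, v}) ` {v \<in> Q. {u, v} \<in> E} = {e \<in> edges_in E Q. u \<in> e}"
  proof (intro equalityI subsetI)
    fix e assume e: "e \<in> {e \<in> edges_in E Q. u \<in> e}"
    then obtain x y where "e = {x, y}"
      using assms(1) by (auto simp: simple_graph_def edges_in_def)
    with e obtain v where "e = {u, v}" by (auto simp: insert_commute)
    with e show "e \<in> (\<lambda>v. {u, v}) ` {v \<in> Q. {u, v} \<in> E}"
      by (auto simp: edges_in_def)
  qed (use assms(2) in \<open>auto simp: edges_in_def\<close>)
  with sum.reindex[OF inj, of s] show ?thesis by (simp add: weight_in_def)
qed

text \<open>Double counting: after exchanging the two sums, each edge inside \<open>Q\<close> is met
  once from each of its two endpoints.\<close>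

lemma sum_weight_in:
  assumes "simple_graph V E" "finite Q"
  shows "(\<Sum>u\<in>Q. weight_in E s c Q u) = 2 * sum s (edges_in E Q) + sum c Q"
proof -
  have "(\<Sum>u\<in>Q. weight_in E s c Q u) = (\<Sum>u\<in>Q. sum s {e \<in> edges_in E Q. u \<in> e}) + sum c Q"
    using assms by (simp add: weight_in_eq sum.distrib)
  also have "(\<Sum>u\<in>Q. sum s {e \<in> edges_in E Q. u \<in> e}) = (\<Sum>e\<in>edges_in E Q. \<Sum>u\<in>{u \<in> Q. u \<in> e}. s e)"
    using assms(2) by (intro sum.swap_restrict finite_edges_in)
  also have "\<dots> = (\<Sum>e\<in>edges_in E Q. 2 * s e)"
  proof (rule sum.cong)
    fix e assume e: "e \<in> edges_in E Q"
    then have "{u \<in> Q. u \<in> e} = e" by (auto simp: edges_in_def)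
    moreover have "card e = 2"
      using e assms(1) by (auto simp: simple_graph_def edges_in_def)
    ultimately show "(\<Sum>u\<in>{u \<in> Q. u \<in> e}. s e) = 2 * s e" by simp
  qed simp
  finally show ?thesis by (simp add: sum_distrib_left)
qed

text \<open>Twice the numerator of the density exceeds the total weight by exactly
  \<open>sum c Q\<close>, which is nonnegative.\<close>

lemma average_weight_le_density:
  assumes "simple_graph V E" "finite Q" "\<And>u. u \<in> Q \<Longrightarrow> c u \<ge> 0"
  shows "(\<Sum>u\<in>Q. weight_in E s c Q u) / real (card Q) \<le> 2 * density E s c Q"
proof -
  have "sum c Q \<ge> 0" using assms(3) by (rule sum_nonneg)
  then have "(\<Sum>u\<in>Q. weight_in E s c Q u) \<le> 2 * (sum s (edges_in E Q) + sum c Q)"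
    using sum_weight_in[OF assms(1,2), of s c] by simp
  then show ?thesis
    unfolding density_eq times_divide_eq_right by (rule divide_right_mono) simp
qed

lemma weight_in_mono:
  assumes "\<And>e. e \<in> E \<Longrightarrow> s e \<ge> 0" "P \<subseteq> Q" "finite Q"
  shows "weight_in E s c P u \<le> weight_in E s c Q u"
  unfolding weight_in_def using assms by (intro add_right_mono sum_mono2) auto

text \<open>Deleting \<open>u\<close> loses exactly the edges at \<open>u\<close> and the node
  weight \<open>c u\<close>. Multiplying by the cardinalities avoids quotients and keeps the case
  \<open>Q = {u}\<close> valid.\<close>

lemma density_remove:
  assumes "simple_graph V E" "finite Q" "u \<in> Q"
  shows "real (card Q) * density E s c Q =
    weight_in E s c Q u + real (card (Q - {u})) * density E s c (Q - {u})"
proof -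
  have card_density: "real (card P) * density E s c P = sum s (edges_in E P) + sum c P"
    if "finite P" for P
  proof (cases "P = {}")
    \<comment> \<open>The factor \<open>card P\<close> makes the left side 0, so the numerator must
      vanish too; it does because no edge is empty.\<close>
    case True
    have "{} \<notin> E" using assms(1) by (auto simp: simple_graph_def)
    then have "edges_in E {} = {}" by (auto simp: edges_in_def)
    then show ?thesis using True by simp
  next
    case False
    then show ?thesis using that by (simp add: density_eq)
  qed
  have "edges_in E Q - {e \<in> edges_in E Q. u \<in> e} = edges_in E (Q - {u})"
    by (auto simp: edges_in_def)
  then have sum_s: "sum s (edges_in E Q) =
      sum s (edges_in E (Q - {u})) + sum s {e \<in> edges_in E Q. u \<in> e}"
    using sum.subset_diff[of "{e \<in> edges_in E Q. u \<in> e}" "edges_in E Q" s]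
      finite_edges_in[OF assms(2), of E] by simp
  have "sum c Q = c u + sum c (Q - {u})"
    using assms(2,3) by (rule sum.remove)
  then show ?thesis
    using sum_s card_density[OF assms(2)] card_density[OF finite_Diff[OF assms(2)], of "{u}"]
      weight_in_eq[OF assms(1,3), of s c] by linarith
qed

text \<open>With n the size of \<open>P\<close> and d its density, deleting \<open>u\<close> gives n
  d = w + (n - 1) d', where w is the weight of \<open>u\<close> and d' the density of the rest.
  Maximality bounds (n - 1) d' by (n - 1) d, which leaves d \<le> w.\<close>

lemma densest_weight_ge_density:
  assumes "simple_graph V E" "finite V" "u \<in> P"
    and max: "is_arg_max (density E s c) (\<lambda>Q. Q \<subseteq> V \<and> Q \<noteq> {}) P"
  shows "density E s c P \<le> weight_in E s c P u"
proof -
  let ?d = "density E s c" and ?k = "real (card (P - {u}))"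
  have "P \<subseteq> V" using max by (simp add: is_arg_max_linorder)
  then have fin: "finite P" using assms(2) finite_subset by blast
  have "?k * ?d (P - {u}) \<le> ?k * ?d P"
  proof (cases "P - {u} = {}")
    case False
    moreover have "P - {u} \<subseteq> V" using \<open>P \<subseteq> V\<close> by auto
    ultimately have "?d (P - {u}) \<le> ?d P"
      using max by (simp add: is_arg_max_linorder)
    then show ?thesis by (rule mult_left_mono) simp
  next
    \<comment> \<open>Maximality says nothing about the empty set, but here the factor
      \<open>?k\<close> is 0.\<close>
    case True
    then show ?thesis by (simp only: card.empty of_nat_0 mult_zero_left)
  qed
  moreover have "real (card P) = 1 + ?k"
    using card.remove[OF fin assms(3)] by linarith
  then have "real (card P) * ?d P = ?d P + ?k * ?d P"
    by (metis distrib_right mult_1)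
  ultimately show ?thesis
    using density_remove[OF assms(1) fin assms(3), of s c] by linarith
qed

text \<open>Each intermediate set contains the nonempty final one, so it is itself nonempty and gets
  recorded; this keeps the first premise true along the induction.\<close>

lemma fold_remove_node_recorded:
  assumes "Q \<in> recs" "Q - set us \<noteq> {}"
  shows "Q - set us \<in> snd (fold remove_node us (Q, recs))"
  using assms
proof (induction us arbitrary: Q recs)
  case (Cons u us)
  have "Q - set (u # us) = (Q - {u}) - set us" by auto
  then show ?case
    using Cons.IH[of "Q - {u}" "insert (Q - {u}) recs"] Cons.prems by auto
qed simp

lemma peel_round_recorded:
  assumes "peel_round E s c (Q, recs) (Q', recs')" "finite recs" "Q \<noteq> {} \<Longrightarrow> Q \<in> recs"
  shows "Q' = Q - low_nodes E s c Q" "recs \<subseteq> recs'" "finite recs'" "Q' \<noteq> {} \<Longrightarrow> Q' \<in> recs'"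
proof -
  from assms(1) obtain us where us: "Q \<noteq> {}" "removal_order E s c Q us"
    and eq: "fold remove_node us (Q, recs) = (Q', recs')"
    by cases auto
  show Q': "Q' = Q - low_nodes E s c Q"
    using fst_fold_remove_node[of us Q recs] us eq by (simp add: removal_order_def)
  show "recs \<subseteq> recs'" "finite recs'"
    using snd_fold_remove_node[OF assms(2), of us Q] eq by auto
  show "Q' \<in> recs'" if "Q' \<noteq> {}"
    using fold_remove_node_recorded[of Q recs us] that assms(3) us eq Q'
    by (simp add: removal_order_def)
qed

text \<open>Loop invariant: either \<open>P\<close> is still intact, or a set at least half as dense
  has already been recorded.\<close>

lemma peel_records_half_dense:
  assumes "finite V" "simple_graph V E"
    and s: "\<And>e. e \<in> E \<Longrightarrow> s e \<ge> 0" and c: "\<And>u. u \<in> V \<Longrightarrow> c u \<ge> 0"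
    and max: "is_arg_max (density E s c) (\<lambda>Q. Q \<subseteq> V \<and> Q \<noteq> {}) P"
    and "(peel_round E s c)\<^sup>*\<^sup>* (V, {V}) (Q, recs)"
  shows "finite recs \<and> Q \<subseteq> V \<and> (Q \<noteq> {} \<longrightarrow> Q \<in> recs) \<and>
    (P \<subseteq> Q \<or> (\<exists>B\<in>recs. density E s c P \<le> 2 * density E s c B))"
  using assms(6)
proof (induction rule: rtranclp_induct2)
  case refl
  then show ?case using max by (simp add: is_arg_max_linorder)
next
  case (step Q recs Q' recs')
  then have Q: "finite recs" "Q \<subseteq> V" "Q \<noteq> {} \<Longrightarrow> Q \<in> recs" by auto
  note rnd = peel_round_recorded[OF step.hyps(2) Q(1,3)]
  have "P \<subseteq> Q' \<or> (\<exists>B\<in>recs'. density E s c P \<le> 2 * density E s c B)"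
  \<comment> \<open>Only the round that first hits \<open>P\<close> needs an argument, with
    \<open>Q\<close> as the witness. Otherwise \<open>P\<close> survives, or the earlier witness
    persists because records only grow.\<close>
  proof (cases "P \<subseteq> Q \<and> \<not> P \<subseteq> Q'")
    case True
    then obtain u where u: "u \<in> P" "u \<in> low_nodes E s c Q" "u \<in> Q"
      using rnd(1) by auto
    have fin: "finite Q" using Q(2) assms(1) finite_subset by blast
    have "density E s c P \<le> weight_in E s c P u"
      using densest_weight_ge_density[OF assms(2,1) u(1) max] .
    also have "\<dots> \<le> weight_in E s c Q u"
      using s True fin by (intro weight_in_mono) auto
    also have "\<dots> \<le> (\<Sum>v\<in>Q. weight_in E s c Q v) / real (card Q)"
      using u(2) by (simp add: low_nodes_def)
    also have "\<dots> \<le> 2 * density E s c Q"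
      using Q(2) c by (intro average_weight_le_density[OF assms(2) fin]) auto
    finally show ?thesis using Q(3) u(3) rnd(2) by auto
  next
    case False
    then show ?thesis using step.IH rnd(2) by auto
  qed
  then show ?case using rnd Q by auto
qed

theorem theorem3:
  fixes V :: "'a set" and E :: "'a set set"
    and s :: "'a set \<Rightarrow> real" and c :: "'a \<Rightarrow> real"
    and Q Qstar :: "'a set"
  assumes "finite V" and "V \<noteq> {}"
    and "simple_graph V E"
    and "\<And>e. e \<in> E \<Longrightarrow> s e \<ge> 0"
    and "\<And>u. u \<in> V \<Longrightarrow> c u \<ge> 0"
    and "peel_output V E s c Q"
    and "is_arg_max (density E s c) (\<lambda>Q'. Q' \<subseteq> V \<and> Q' \<noteq> {}) Qstar"
  shows "density E s c Q \<ge> 1 / 2 * density E s c Qstar"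
proof -
  obtain recs where recs: "(peel_round E s c)\<^sup>*\<^sup>* (V, {V}) ({}, recs)"
    and Q: "is_arg_max (density E s c) (\<lambda>Q'. Q' \<in> recs) Q"
    using assms(6) by (auto simp: peel_output_def)
  \<comment> \<open>At termination the current set is empty, so only the second alternative of the
    invariant remains.\<close>
  have "\<not> Qstar \<subseteq> {}" using assms(7) by (simp add: is_arg_max_linorder)
  then obtain B where "B \<in> recs" "density E s c Qstar \<le> 2 * density E s c B"
    using peel_records_half_dense[OF assms(1,3,4,5,7) recs] by blast
  moreover from this have "density E s c B \<le> density E s c Q"
    using Q by (simp add: is_arg_max_linorder)
  ultimately show ?thesis by simp
qed

end
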